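(* Let $n\ge 1$ be an integer and let $q\colon\mathbb{R}^{n}\to\mathbb{R}$ be a positive-definite quadratic form, $q(x)={}^{\mathrm{t}}xA(q)x$ with $A(q)$ a symmetric matrix, such that $A(q)$ has integral coefficients. Assume that there exists $x\in\mathbb{Q}^{n}$ such that $q(x)=1$. Then, for all $\alpha\in\mathbb{R}^{n}$ such that $q(\alpha)=1$ and for every real number $T\ge (2\gamma_{n})^{n/2}\sqrt{\det q}$, there exist $\upsilon\in\mathbb{Z}^{n}$ and $\phi\in\mathbb{Z}$ with $1\le\phi\le T$ satisfying \[q\left(\frac{\upsilon}{\phi}\right)=1\quad\text{and}\quad q\left(\alpha-\frac{\upsilon}{\phi}\right)\le\frac{\sqrt{8}(2\gamma_{n})^{n}\det q}{\phi T}.\]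
   Context: $\gamma_{n}$ denotes the Hermite constant in dimension $n$, i.e. the greatest first minimum of unimodular lattices in the Euclidean space $\mathbb{R}^{n}$. $\det q$ denotes the determinant of the symmetric matrix $A(q)$ of $q$ in the canonical basis of $\mathbb{R}^{n}$. *)

theory Defs
  imports "HOL-Analysis.Analysis"
begin

definition integer_vectors :: "(real ^ 'n) set" where
  "integer_vectors = {z. \<forall>i. z $ i \<in> \<int>}"

definition rational_vectors :: "(real ^ 'n) set" where
  "rational_vectors = {z. \<forall>i. z $ i \<in> \<rat>}"

text \<open>Full-rank lattices of covolume 1: the columns of \<open>B\<close> form a \<open>\<int>\<close>-basis of the lattice.\<close>

definition unimodular_lattices :: "(real ^ 'n) set set" where
  "unimodular_lattices = {L. \<exists>B :: real ^ 'n ^ 'n. \<bar>det B\<bar> = 1 \<and> L = (*v) B ` integer_vectors}"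

text \<open>The minimum of the squared Euclidean norm over the nonzero lattice vectors; squaring is
  the convention of Hermite's inequality, \<open>min q \<le> \<gamma>\<^sub>n (det q) powr (1 / n)\<close>.\<close>

definition lattice_minimum :: "(real ^ 'n) set \<Rightarrow> real" where
  "lattice_minimum L = (INF x \<in> L - {0}. (norm x)\<^sup>2)"

text \<open>The type argument carries the dimension: \<open>hermite_constant TYPE('n)\<close> is the constant
  in dimension \<open>CARD('n)\<close>. The supremum is of a nonempty set which is bounded above.\<close>

definition hermite_constant :: "'n::finite itself \<Rightarrow> real" where
  "hermite_constant _ = (SUP L \<in> (unimodular_lattices :: (real ^ 'n) set set). lattice_minimum L)"

end

theory Submission
  imports Defs
begin

text \<open>Give \<open>q(x) - t\<^sup>2\<close> on \<open>\<real>\<^sup>n \<times> \<real>\<close> the role of a Lorentz form. An integral point \<open>(v, \<phi>)\<close>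
  of its light cone is a rational point \<open>v / \<phi>\<close> of \<open>q = 1\<close>. Following the argument of Cassels and
  Davenport for small zeros of quadratic forms, take such a point of minimal height, where the height
  is the Euclidean norm deformed by a hyperbolic flow contracting the direction of \<open>(\<alpha>, 1)\<close>. For each
  nonzero \<open>y\<close> in the lattice generated by \<open>\<int>\<^sup>n\<close> and \<open>v / \<phi>\<close>, the reflection of \<open>(v, \<phi>)\<close> along \<open>y\<close>,
  scaled by \<open>q(y)\<close>, is again such a point, and the ratio of the heights is a positive definite
  quadratic form in \<open>y\<close>. By minimality this form is at least 1 on the lattice; its determinant is
  \<open>4 \<phi>\<^sup>2 det q\<close> over the squared height, and the lattice has covolume \<open>1 / \<phi>\<close>, so Hermite's inequality
  bounds the squared height by \<open>4 \<gamma>\<^sub>n\<^sup>n det q\<close>. Choosing the time of the flow in terms of \<open>T\<close> yields both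
  inequalities.\<close>

section \<open>Integer vectors\<close>

lemma integer_vectors_arith:
  assumes "x \<in> integer_vectors" "y \<in> integer_vectors"
  shows "x + y \<in> integer_vectors" "x - y \<in> integer_vectors"
  using assms by (auto simp: integer_vectors_def)

lemma integer_vectors_scaleR:
  assumes "c \<in> \<int>" "x \<in> integer_vectors"
  shows "c *\<^sub>R x \<in> integer_vectors"
  using assms by (auto simp: integer_vectors_def)

lemma axis_in_integer_vectors [simp]: "axis k 1 \<in> integer_vectors"
  by (auto simp: integer_vectors_def axis_def)

lemma matrix_vector_mult_integer_vectors:
  fixes M :: "real ^ 'n ^ 'm"
  assumes "\<And>i j. M $ i $ j \<in> \<int>" "x \<in> integer_vectors"
  shows "M *v x \<in> integer_vectors"
  using assms by (auto simp: integer_vectors_def matrix_vector_mult_def)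

lemma inner_integer_vectors:
  assumes "x \<in> integer_vectors" "y \<in> integer_vectors"
  shows "x \<bullet> y \<in> \<int>"
  using assms by (auto simp: integer_vectors_def inner_vec_def)

lemma integer_vectors_eq_range:
  "(integer_vectors :: (real ^ 'n) set) = range (\<lambda>f. \<chi> i. of_int (f i))"
proof -
  have "x \<in> range (\<lambda>f. \<chi> i. of_int (f i))" if "x \<in> integer_vectors" for x :: "real ^ 'n"
    using that by (intro image_eqI[of _ _ "\<lambda>i. \<lfloor>x $ i\<rfloor>"])
      (auto simp: integer_vectors_def vec_eq_iff elim!: Ints_cases)
  then show ?thesis
    by (auto simp: integer_vectors_def)
qed

lemma countable_integer_vectors: "countable (integer_vectors :: (real ^ 'n) set)"
  unfolding integer_vectors_eq_range by simp

lemma finite_bounded_integer_vectors: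
  "finite {z \<in> integer_vectors. norm (z :: real ^ 'n) \<le> r}"
proof -
  let ?F = "UNIV \<rightarrow>\<^sub>E {x. abs x \<le> \<lceil>r\<rceil>} :: ('n \<Rightarrow> int) set"
  have fin: "finite {x::int. \<bar>x\<bar> \<le> \<lceil>r\<rceil>}"
    by (rule finite_subset[of _ "{-\<lceil>r\<rceil>..\<lceil>r\<rceil>}"]) auto
  have "z \<in> (\<lambda>f. \<chi> i. of_int (f i)) ` ?F"
    if z: "z \<in> integer_vectors" "norm z \<le> r" for z :: "real ^ 'n"
  proof -
    obtain f :: "'n \<Rightarrow> int" where f: "z = (\<chi> i. of_int (f i))"
      using z(1) unfolding integer_vectors_eq_range by auto
    have "\<bar>f i\<bar> \<le> \<lceil>r\<rceil>" for i
    proof -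
      have "\<bar>z $ i\<bar> \<le> r" using component_le_norm_cart[of z i] z(2) by linarith
      then show ?thesis unfolding f by simp linarith
    qed
    then show ?thesis by (auto simp: f)
  qed
  then have "{z \<in> integer_vectors. norm z \<le> r} \<subseteq> (\<lambda>f. \<chi> i. of_int (f i)) ` ?F" by auto
  then show ?thesis by (rule finite_subset) (intro finite_imageI finite_PiE fin, auto)
qed

section \<open>Minkowski's theorem for a cube\<close>

text \<open>Cut \<open>S\<close> along the integer translates of the half-open unit cube and move
  every piece into that cube. If no two points of \<open>S\<close> differed by an integer vector,
  the moved pieces would be disjoint and the volume at most 1.\<close>

theorem blichfeldt:
  fixes S :: "(real ^ 'n) set"
  assumes S: "S \<in> lmeasurable" and gt: "measure lebesgue S > 1"
  shows "\<exists>x\<in>S. \<exists>y\<in>S. x \<noteq> y \<and> x - y \<in> integer_vectors"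
proof (rule ccontr)
  assume contra: "\<not> ?thesis"
  let ?Z = "integer_vectors :: (real ^ 'n) set"
  define Q :: "(real ^ 'n) set" where "Q = {x. \<forall>i. 0 \<le> x $ i \<and> x $ i < 1}"
  define X where "X z = S \<inter> (+) z ` Q" for z
  define Y where "Y z = (\<lambda>x. x - z) ` X z" for z
  have "Q \<in> sets borel"
    unfolding Q_def by measurable
  then have Q: "Q \<in> sets lebesgue" by simp
  have X: "X z \<in> lmeasurable" for z
    unfolding X_def using S Q by (intro fmeasurable_Int_fmeasurable lebesgue_sets_translation) auto
  have Y: "Y z \<in> lmeasurable" for z
    unfolding Y_def by (rule measurable_translation_subtract[OF X])
  \<comment> \<open>The translates of the half-open cube are disjoint: the one containing
    \<open>x\<close> belongs to the coordinatewise floor of \<open>x\<close>.\<close>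
  have uniq: "z = floor_z" 
    if "x \<in> (+) z ` Q" "z \<in> ?Z" "floor_z = (\<chi> i. of_int \<lfloor>x $ i\<rfloor>)" for x z floor_z
  proof -
    obtain u where u: "u \<in> Q" "x = z + u" using \<open>x \<in> (+) z ` Q\<close> by auto
    have "z $ i = of_int \<lfloor>x $ i\<rfloor>" for i
    proof -
      obtain k where k: "z $ i = of_int k"
        using \<open>z \<in> ?Z\<close> by (auto simp: integer_vectors_def elim: Ints_cases)
      have "\<lfloor>x $ i\<rfloor> = k" using u k by (auto simp: Q_def floor_eq_iff)
      then show ?thesis using k by simp
    qed
    then show ?thesis using that by (simp add: vec_eq_iff)
  qed
  have "S = (\<Union>z\<in>?Z. X z)"
  proof -
    have "\<exists>z\<in>?Z. x \<in> (+) z ` Q" for x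
    proof (intro bexI image_eqI)
      show "x = (\<chi> i. of_int \<lfloor>x $ i\<rfloor>) + (\<chi> i. frac (x $ i))"
        by (simp add: vec_eq_iff frac_def)
    qed (auto simp: Q_def integer_vectors_def frac_lt_1)
    then show ?thesis by (auto simp: X_def)
  qed
  moreover have "disjoint_family_on X ?Z"
    unfolding disjoint_family_on_def
  proof (intro ballI impI, rule ccontr)
    fix z w assume "z \<in> ?Z" "w \<in> ?Z" "z \<noteq> w" and "X z \<inter> X w \<noteq> {}"
    then obtain x where "x \<in> (+) z ` Q" "x \<in> (+) w ` Q" unfolding X_def by blast
    then show False
      using uniq[OF _ \<open>z \<in> ?Z\<close> refl, of x] uniq[OF _ \<open>w \<in> ?Z\<close> refl, of x] \<open>z \<noteq> w\<close> by simp
  qed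
  ultimately have "emeasure lebesgue S = (\<integral>\<^sup>+z. emeasure lebesgue (X z) \<partial>count_space ?Z)"
    using emeasure_UN_countable[of ?Z X lebesgue] X countable_integer_vectors
    by (simp add: fmeasurableD)
  also have "\<dots> = (\<integral>\<^sup>+z. emeasure lebesgue (Y z) \<partial>count_space ?Z)"
  proof (intro nn_integral_cong)
    fix z
    show "emeasure lebesgue (X z) = emeasure lebesgue (Y z)"
      using X[of z] Y[of z] by (simp add: emeasure_eq_measure2 Y_def measure_translation_subtract)
  qed
  also have "\<dots> = emeasure lebesgue (\<Union>z\<in>?Z. Y z)"
  proof (rule emeasure_UN_countable[symmetric])
    show "disjoint_family_on Y ?Z"
      unfolding disjoint_family_on_def
    proof (intro ballI impI, rule ccontr)
      fix z w assume zw: "z \<in> ?Z" "w \<in> ?Z" "z \<noteq> w" and "Y z \<inter> Y w \<noteq> {}"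
      then obtain x y where xy: "x \<in> X z" "y \<in> X w" "x - z = y - w" unfolding Y_def by auto
      then have "x - y = z - w" by (simp add: algebra_simps)
      moreover have "z - w \<in> ?Z" using zw integer_vectors_arith(2) by blast
      ultimately show False using contra xy zw unfolding X_def by (metis IntE right_minus_eq)
    qed
  qed (use Y countable_integer_vectors in \<open>auto simp: fmeasurableD\<close>)
  also have "\<dots> \<le> emeasure lebesgue (cbox 0 (\<chi> i. 1) :: (real ^ 'n) set)"
    by (rule emeasure_mono) (auto simp: Y_def X_def Q_def mem_box_cart less_imp_le)
  also have "\<dots> = 1"
    by (simp add: emeasure_eq_measure2 content_cbox_cart interval_ne_empty_cart)
  finally show False
    using gt S by (simp add: emeasure_eq_measure2)
qed

text \<open>Blichfeldt's theorem is applied to the image of \<open>[-1, 1]^n\<close> under the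
  inverse of \<open>B\<close>, of volume \<open>2 ^ n\<close>. The bound 2, weaker than Minkowski's
  1, is enough to bound lattice minima.\<close>

lemma minkowski_cube_wellorder:
  fixes B :: "real ^ ('n::{finite,wellorder}) ^ ('n::{finite,wellorder})"
  assumes det: "\<bar>det B\<bar> = 1"
  shows "\<exists>z\<in>integer_vectors. z \<noteq> 0 \<and> (\<forall>i. \<bar>(B *v z) $ i\<bar> \<le> 2)"
proof -
  have "invertible B" using det by (auto simp: invertible_det_nz)
  then obtain C where C: "B ** C = mat 1" "C ** B = mat 1" by (auto simp: invertible_def)
  have "det B * det C = 1" using C by (metis det_I det_mul)
  then have detC: "\<bar>det C\<bar> = 1" using det by (metis abs_mult abs_1 mult_1)
  let ?c = "cbox (\<chi> i. - 1) (\<chi> i. 1) :: (real, 'n) vec set"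
  have "measure lebesgue ?c = 2 ^ CARD('n)"
    by (simp add: content_cbox_cart interval_ne_empty_cart)
  then have "measure lebesgue ((*v) C ` ?c) = 2 ^ CARD('n)"
    using measure_linear_image[of "(*v) C" ?c] detC by simp
  then have "measure lebesgue ((*v) C ` ?c) > 1" by simp
  moreover have "(*v) C ` ?c \<in> lmeasurable"
    by (intro measurable_linear_image) auto
  ultimately obtain u w where uw: "u \<in> ?c" "w \<in> ?c" "C *v u \<noteq> C *v w"
      "C *v u - C *v w \<in> integer_vectors"
    using blichfeldt by blast
  have "B *v (C *v u - C *v w) = u - w"
    using C by (simp add: matrix_vector_mult_diff_distrib matrix_vector_mul_assoc)
  moreover have "\<bar>(u - w) $ i\<bar> \<le> 2" for i
    using uw(1,2)[unfolded mem_box_cart, THEN spec, of i] by simp linarith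
  ultimately show ?thesis
    using uw by (intro bexI[of _ "C *v u - C *v w"]) auto
qed

text \<open>The change of variables formula of the library needs a well-ordered index type, which an
  arbitrary finite type becomes by transport along an enumeration.\<close>

typedef 'a enumerated = "UNIV :: 'a set" by auto

lemma bij_Rep_enumerated: "bij Rep_enumerated"
  by (metis Abs_enumerated_inverse Rep_enumerated_inverse UNIV_I bij_betw_byWitness subset_UNIV)

instance enumerated :: (finite) finite
proof
  have "finite (range (Rep_enumerated :: 'a enumerated \<Rightarrow> 'a))" by simp
  then show "finite (UNIV :: 'a enumerated set)"
    by (rule finite_imageD) (rule bij_is_inj[OF bij_Rep_enumerated])
qed

definition enumeration :: "'a::finite \<Rightarrow> nat" where
  "enumeration = (SOME f. inj f)"

lemma inj_enumeration: "inj (enumeration :: 'a::finite \<Rightarrow> nat)"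
proof -
  have "\<exists>f :: 'a \<Rightarrow> nat. inj f"
    using finite_imp_inj_to_nat_seg[of "UNIV :: 'a set"] by auto
  then show ?thesis unfolding enumeration_def by (rule someI_ex)
qed

instantiation enumerated :: (finite) wellorder
begin

definition less_eq_enumerated :: "'a enumerated \<Rightarrow> 'a enumerated \<Rightarrow> bool" where
  "x \<le> y \<longleftrightarrow> enumeration (Rep_enumerated x) \<le> enumeration (Rep_enumerated y)"

definition less_enumerated :: "'a enumerated \<Rightarrow> 'a enumerated \<Rightarrow> bool" where
  "x < y \<longleftrightarrow> enumeration (Rep_enumerated x) < enumeration (Rep_enumerated y)"

instance
proof
  fix x y :: "'a enumerated"
  assume "x \<le> y" "y \<le> x"
  then show "x = y"
    by (simp add: less_eq_enumerated_def inj_eq[OF inj_enumeration] Rep_enumerated_inject)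
next
  fix P :: "'a enumerated \<Rightarrow> bool" and a
  assume step: "\<And>x. (\<And>y. y < x \<Longrightarrow> P y) \<Longrightarrow> P x"
  show "P a"
  proof (induction a rule: measure_induct_rule[where f = "\<lambda>x. enumeration (Rep_enumerated x)"])
    case (less x)
    show ?case by (rule step, rule less) (simp add: less_enumerated_def)
  qed
qed (auto simp: less_eq_enumerated_def less_enumerated_def)

end

section \<open>Determinants under a change of index type\<close>

text \<open>Conjugation by \<open>f\<close> turns the transposition of \<open>a\<close> and
  \<open>b\<close> into that of \<open>f a\<close> and \<open>f b\<close>, so it preserves the
  length of a product of transpositions.\<close>

lemma swapidseq_conjugate:
  assumes "swapidseq n p" and f: "bij f"
  shows "swapidseq n (f \<circ> p \<circ> inv f)"
  using assms(1)
proof induction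
  case id
  then show ?case using f by (auto simp: fun_eq_iff bij_is_surj surj_f_inv_f)
next
  case (comp_Suc n p a b)
  have "f \<circ> (Transposition.transpose a b \<circ> p) \<circ> inv f =
      Transposition.transpose (f a) (f b) \<circ> (f \<circ> p \<circ> inv f)"
    using f by (auto simp: fun_eq_iff Transposition.transpose_def bij_is_inj inj_eq)
  moreover have "f a \<noteq> f b" using comp_Suc f by (simp add: bij_is_inj inj_eq)
  ultimately show ?case using comp_Suc by (metis swapidseq.comp_Suc)
qed

lemma sign_conjugate:
  assumes f: "bij f" and "permutation p"
  shows "sign (f \<circ> p \<circ> inv f) = sign p"
proof -
  obtain n where n: "swapidseq n p" using assms by (auto simp: permutation_def)
  show ?thesis
    using evenperm_unique[OF n refl] evenperm_unique[OF swapidseq_conjugate[OF n f] refl]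
    by (simp add: sign_def)
qed

text \<open>Conjugation by \<open>f\<close> is a sign-preserving bijection between the permutations
  of the two index types and matches the Leibniz sums term by term.\<close>

lemma det_reindex:
  fixes A :: "'a::comm_ring_1 ^ 'n ^ 'n" and f :: "'m::finite \<Rightarrow> 'n::finite"
  assumes f: "bij f"
  shows "det (\<chi> i j. A $ f i $ f j) = det A"
proof -
  let ?c = "\<lambda>p. f \<circ> p \<circ> inv f"
  have "bij_betw ?c {p. p permutes UNIV} {p. p permutes UNIV}"
  proof (rule bij_betw_byWitness[where f' = "\<lambda>p. inv f \<circ> p \<circ> f"])
    show "?c ` {p. p permutes UNIV} \<subseteq> {p. p permutes UNIV}"
      using f by (auto intro!: bij_imp_permutes bij_comp bij_imp_bij_inv permutes_bij)
    show "(\<lambda>p. inv f \<circ> p \<circ> f) ` {p. p permutes UNIV} \<subseteq> {p. p permutes UNIV}"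
      using f by (auto intro!: bij_imp_permutes bij_comp bij_imp_bij_inv permutes_bij)
  qed (use f in \<open>auto simp: fun_eq_iff bij_is_inj bij_is_surj surj_f_inv_f\<close>)
  then have "det A = (\<Sum>p | p permutes UNIV. of_int (sign (?c p)) * (\<Prod>i\<in>UNIV. A $ i $ ?c p i))"
    unfolding det_def by (rule sum.reindex_bij_betw[symmetric])
  also have "\<dots> = (\<Sum>p | p permutes UNIV. of_int (sign p) * (\<Prod>i\<in>UNIV. A $ f i $ f (p i)))"
  proof (intro sum.cong refl)
    fix p :: "'m \<Rightarrow> 'm" assume "p \<in> {p. p permutes UNIV}"
    then have "permutation p" by (auto intro: permutes_imp_permutation[of UNIV])
    moreover have "(\<Prod>i\<in>UNIV. A $ i $ ?c p i) = (\<Prod>i\<in>UNIV. A $ f i $ ?c p (f i))"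
      using f by (rule prod.reindex_bij_betw[symmetric])
    ultimately show "of_int (sign (?c p)) * (\<Prod>i\<in>UNIV. A $ i $ ?c p i) =
        of_int (sign p) * (\<Prod>i\<in>UNIV. A $ f i $ f (p i))"
      using f by (simp add: sign_conjugate bij_is_inj)
  qed
  finally show ?thesis by (simp add: det_def)
qed

theorem minkowski_cube:
  fixes B :: "real ^ 'n ^ 'n"
  assumes det: "\<bar>det B\<bar> = 1"
  shows "\<exists>z\<in>integer_vectors. z \<noteq> 0 \<and> (\<forall>i. \<bar>(B *v z) $ i\<bar> \<le> 2)"
proof -
  let ?f = "Rep_enumerated :: 'n enumerated \<Rightarrow> 'n"
  have "\<bar>det (\<chi> i j. B $ ?f i $ ?f j)\<bar> = 1"
    using det by (simp add: det_reindex bij_Rep_enumerated)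
  then obtain w where w: "w \<in> integer_vectors" "w \<noteq> 0"
      "\<And>i. \<bar>((\<chi> i j. B $ ?f i $ ?f j) *v w) $ i\<bar> \<le> 2"
    using minkowski_cube_wellorder by blast
  define z where "z = (\<chi> i. w $ Abs_enumerated i)"
  have "(B *v z) $ i = ((\<chi> i j. B $ ?f i $ ?f j) *v w) $ Abs_enumerated i" for i
    using sum.reindex_bij_betw[OF bij_Rep_enumerated, of "\<lambda>j. B $ i $ j * z $ j"]
    by (simp add: matrix_vector_mult_def z_def Rep_enumerated_inverse Abs_enumerated_inverse)
  moreover have "z \<noteq> 0"
    using w(2) by (auto simp: z_def vec_eq_iff) (metis Rep_enumerated_inverse)
  moreover have "z \<in> integer_vectors"
    using w(1) by (simp add: z_def integer_vectors_def)
  ultimately show ?thesis using w(3) by auto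
qed

section \<open>Finiteness of the Hermite constant\<close>

text \<open>This is what allows the supremum in \<open>hermite_constant\<close> to be used as an
  upper bound.\<close>

lemma bdd_above_lattice_minimum:
  "bdd_above (lattice_minimum ` (unimodular_lattices :: (real ^ 'n) set set))"
proof (intro bdd_aboveI2)
  fix L :: "(real ^ 'n) set" assume "L \<in> unimodular_lattices"
  then obtain B :: "real ^ 'n ^ 'n" where B: "\<bar>det B\<bar> = 1" "L = (*v) B ` integer_vectors"
    by (auto simp: unimodular_lattices_def)
  obtain z where z: "z \<in> integer_vectors" "z \<noteq> 0" "\<And>i. \<bar>(B *v z) $ i\<bar> \<le> 2"
    using minkowski_cube[OF B(1)] by blast
  have "invertible B" using B by (auto simp: invertible_det_nz)
  then have "B *v z \<noteq> 0" using z(2) by (metis invertible_def matrix_left_invertible_ker)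
  then have "lattice_minimum L \<le> (norm (B *v z))\<^sup>2"
    unfolding lattice_minimum_def using B(2) z(1)
    by (intro cINF_lower) (auto intro!: bdd_belowI2[of _ 0])
  also have "\<dots> \<le> (2 * real CARD('n))\<^sup>2"
  proof (rule power_mono)
    have "norm (B *v z) \<le> (\<Sum>i\<in>UNIV. \<bar>(B *v z) $ i\<bar>)" by (rule norm_le_l1_cart)
    also have "\<dots> \<le> (\<Sum>i\<in>(UNIV :: 'n set). 2)" by (intro sum_mono z(3))
    finally show "norm (B *v z) \<le> 2 * real CARD('n)" by simp
  qed simp
  finally show "lattice_minimum L \<le> (2 * real CARD('n))\<^sup>2" .
qed

section \<open>Positive definite forms\<close>

lemma inner_symmetric_matrix:
  fixes A :: "real ^ 'n ^ 'n"
  assumes "transpose A = A"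
  shows "x \<bullet> (A *v y) = y \<bullet> (A *v x)"
  using assms by (metis dot_lmul_matrix inner_commute transpose_matrix_vector)

text \<open>Gram-Schmidt for the inner product of \<open>H\<close>: fewer than \<open>n\<close>
  vectors leave some \<open>x\<close> outside their span; subtract its \<open>H\<close>-projection
  and normalize.\<close>

lemma exists_orthonormal_family:
  fixes H :: "real ^ 'n ^ 'n" and S :: "'n set"
  assumes sym: "transpose H = H" and pos: "\<And>x. x \<noteq> 0 \<Longrightarrow> x \<bullet> (H *v x) > 0"
  shows "\<exists>p :: 'n \<Rightarrow> real ^ 'n. \<forall>i\<in>S. \<forall>j\<in>S. p i \<bullet> (H *v p j) = (if i = j then 1 else 0)"
  using finite[of S]
proof (induction S rule: finite_induct)
  case (insert k S)
  then obtain p :: "'n \<Rightarrow> real ^ 'n"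
    where p: "\<And>i j. i \<in> S \<Longrightarrow> j \<in> S \<Longrightarrow> p i \<bullet> (H *v p j) = (if i = j then 1 else 0)"
    by auto
  have "dim (span (p ` S)) \<le> card (p ` S)"
    by (simp add: dim_le_card')
  also have "\<dots> \<le> card S" by (rule card_image_le) simp
  also have "\<dots> < CARD('n)"
    using insert by (intro psubset_card_mono) auto
  finally have "dim (span (p ` S)) < DIM(real ^ 'n)" by simp
  then have "span (p ` S) \<noteq> UNIV" by (metis dim_UNIV less_irrefl)
  then obtain x where x: "x \<notin> span (p ` S)" by auto
  define y where "y = x - (\<Sum>i\<in>S. (x \<bullet> (H *v p i)) *\<^sub>R p i)"
  have "(\<Sum>i\<in>S. (x \<bullet> (H *v p i)) *\<^sub>R p i) \<in> span (p ` S)"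
    by (intro span_sum span_scale span_base) auto
  then have "y \<noteq> 0" using x by (auto simp: y_def)
  then have ypos: "y \<bullet> (H *v y) > 0" by (rule pos)
  have orth: "y \<bullet> (H *v p j) = 0" if "j \<in> S" for j
  proof -
    have "(\<Sum>i\<in>S. (x \<bullet> (H *v p i)) * (p i \<bullet> (H *v p j))) =
        (\<Sum>i\<in>S. if i = j then x \<bullet> (H *v p i) else 0)"
      using p that by (intro sum.cong) auto
    then show ?thesis
      using that by (simp add: y_def inner_diff_left inner_sum_left)
  qed
  define p' where "p' = p(k := (1 / sqrt (y \<bullet> (H *v y))) *\<^sub>R y)"
  have "p' k \<bullet> (H *v p' k) = 1"
    using ypos by (simp add: p'_def matrix_vector_mult_scaleR)
  moreover have "p' k \<bullet> (H *v p' j) = 0" if "j \<in> S" for j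
    using that insert.hyps orth[of j] by (auto simp: p'_def)
  moreover have "p' i = p i" if "i \<in> S" for i
    using that insert.hyps by (auto simp: p'_def)
  ultimately have "p' i \<bullet> (H *v p' j) = (if i = j then 1 else 0)"
    if "i \<in> insert k S" "j \<in> insert k S" for i j
    using that p insert.hyps(2) inner_symmetric_matrix[OF sym, of "p' i" "p' k"]
    by (cases "i = k"; cases "j = k") auto
  then show ?case by blast
qed simp

text \<open>If the columns of \<open>P\<close> are an \<open>H\<close>-orthonormal basis, then
  \<open>transpose P ** H ** P\<close> is the identity, and \<open>C\<close> is the inverse of
  \<open>P\<close>.\<close>

lemma gram_factorization:
  fixes H :: "real ^ 'n ^ 'n"
  assumes sym: "transpose H = H" and pos: "\<And>x. x \<noteq> 0 \<Longrightarrow> x \<bullet> (H *v x) > 0"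
  obtains C :: "real ^ 'n ^ 'n" where "transpose C ** C = H" "det C \<noteq> 0"
proof -
  obtain p :: "'n \<Rightarrow> real ^ 'n" where p: "\<And>i j. p i \<bullet> (H *v p j) = (if i = j then 1 else 0)"
    using exists_orthonormal_family[OF assms, of UNIV] by auto
  define P where "P = (\<chi> i j. p j $ i)"
  have "(transpose P ** (H ** P)) $ i $ j = p i \<bullet> (H *v p j)" for i j
    by (simp add: matrix_matrix_mult_def matrix_vector_mult_def inner_vec_def transpose_def P_def)
  then have one: "transpose P ** (H ** P) = mat 1"
    using p by (simp add: vec_eq_iff mat_def)
  then have "det P * (det H * det P) = 1"
    by (metis det_I det_mul det_transpose)
  then have "det P \<noteq> 0" by auto
  then obtain C where C: "P ** C = mat 1" "C ** P = mat 1"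
    by (auto simp: invertible_det_nz[symmetric] invertible_def)
  have "transpose C ** transpose P = mat 1"
    using C by (simp flip: matrix_transpose_mul)
  then have "transpose C ** C = (transpose C ** transpose P) ** H ** (P ** C)"
    using one by (metis matrix_mul_assoc matrix_mul_lid matrix_mul_rid)
  also have "\<dots> = H"
    using \<open>transpose C ** transpose P = mat 1\<close> C by simp
  finally have "transpose C ** C = H" .
  moreover have "det C \<noteq> 0" using C by (metis det_I det_mul mult_zero_right zero_neq_one)
  ultimately show ?thesis using that by blast
qed

lemma inner_gram:
  fixes C :: "real ^ 'n ^ 'n"
  shows "x \<bullet> ((transpose C ** C) *v y) = (C *v x) \<bullet> (C *v y)"
  by (metis dot_lmul_matrix matrix_vector_mul_assoc transpose_matrix_vector transpose_transpose)

text \<open>With \<open>H\<close> the Gram matrix of \<open>C\<close>, the values of the form are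
  the squared norms in the lattice generated by the columns of \<open>C\<close>, which is rescaled
  to covolume 1.\<close>

theorem hermite_inequality:
  fixes H :: "real ^ 'n ^ 'n"
  assumes sym: "transpose H = H" and pos: "\<And>x. x \<noteq> 0 \<Longrightarrow> x \<bullet> (H *v x) > 0"
    and m: "m > 0" and min: "\<And>z. z \<in> integer_vectors \<Longrightarrow> z \<noteq> 0 \<Longrightarrow> m \<le> z \<bullet> (H *v z)"
  shows "m ^ CARD('n) \<le> hermite_constant TYPE('n) ^ CARD('n) * det H"
    and "hermite_constant TYPE('n) > 0"
proof -
  obtain C where C: "transpose C ** C = H" "det C \<noteq> 0"
    using gram_factorization[OF sym pos] by blast
  \<comment> \<open>The n-th root of the covolume, so that \<open>C\<close> divided by
    \<open>t\<close> has determinant 1 up to sign.\<close>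
  define t where "t = root CARD('n) \<bar>det C\<bar>"
  have t: "t > 0" "t ^ CARD('n) = \<bar>det C\<bar>"
    using C by (auto simp: t_def)
  define U where "U = C ** mat (1 / t)"
  define L where "L = (*v) U ` integer_vectors"
  have U: "U *v z = (1 / t) *\<^sub>R (C *v z)" for z
    by (simp add: U_def flip: matrix_vector_mul_assoc)
      (simp add: vec_eq_iff matrix_vector_mult_def mat_def if_distrib[of "\<lambda>c. c * _"]
        sum_distrib_left mult.left_commute cong: if_cong)
  have "\<bar>det U\<bar> = 1"
  proof -
    have "det (mat (1 / t) :: real ^ 'n ^ 'n) = (1 / t) ^ CARD('n)"
      by (subst det_diagonal) (auto simp: mat_def)
    then show ?thesis using t C(2) by (simp add: U_def det_mul abs_mult power_one_over)
  qed
  then have "L \<in> unimodular_lattices" by (auto simp: unimodular_lattices_def L_def)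
  then have "lattice_minimum L \<le> hermite_constant TYPE('n)"
    unfolding hermite_constant_def by (rule cSUP_upper[OF _ bdd_above_lattice_minimum])
  moreover have "m / t\<^sup>2 \<le> lattice_minimum L"
    unfolding lattice_minimum_def
  proof (rule cINF_greatest)
    have "U *v axis undefined 1 \<noteq> 0"
      using \<open>\<bar>det U\<bar> = 1\<close> matrix_left_invertible_ker[of U]
      by (metis abs_zero axis_eq_0_iff invertible_def invertible_det_nz zero_neq_one)
    then show "L - {0} \<noteq> {}" unfolding L_def using axis_in_integer_vectors by blast
  next
    fix x assume "x \<in> L - {0}"
    then obtain z where z: "z \<in> integer_vectors" "x = U *v z" "x \<noteq> 0" by (auto simp: L_def)
    then have "z \<noteq> 0" by auto
    then have "m \<le> (C *v z) \<bullet> (C *v z)" using min[OF z(1)] C(1) by (metis inner_gram)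
    then show "m / t\<^sup>2 \<le> (norm x)\<^sup>2"
      using t by (simp add: z U power_divide divide_right_mono power2_norm_eq_inner)
  qed
  ultimately have le: "m / t\<^sup>2 \<le> hermite_constant TYPE('n)" by linarith
  moreover have "m / t\<^sup>2 > 0" using m t by simp
  ultimately show "hermite_constant TYPE('n) > 0" by linarith
  have "m \<le> hermite_constant TYPE('n) * t\<^sup>2" using le t by (simp add: field_simps)
  then have "m ^ CARD('n) \<le> (hermite_constant TYPE('n) * t\<^sup>2) ^ CARD('n)"
    using m by (intro power_mono) auto
  also have "\<dots> = hermite_constant TYPE('n) ^ CARD('n) * (t\<^sup>2) ^ CARD('n)"
    by (rule power_mult_distrib)
  also have "(t\<^sup>2) ^ CARD('n) = (det C)\<^sup>2"
    using t(2) by (metis power2_abs power_mult mult.commute)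
  also have "(det C)\<^sup>2 = det H"
    unfolding C(1)[symmetric] by (simp add: det_mul power2_eq_square)
  finally show "m ^ CARD('n) \<le> hermite_constant TYPE('n) ^ CARD('n) * det H" .
qed

section \<open>Determinants of low rank perturbations\<close>

definition outer_product :: "real ^ 'm \<Rightarrow> real ^ 'n \<Rightarrow> real ^ 'n ^ 'm" where
  "outer_product x y = (\<chi> i j. x $ i * y $ j)"

lemma matrix_add_rdistrib:
  fixes A B :: "real ^ 'm ^ 'n"
  shows "(A + B) ** C = A ** C + B ** C"
  by (simp add: vec_eq_iff matrix_matrix_mult_def sum.distrib distrib_right)

lemma outer_product_mult_vec: "outer_product x y *v z = (y \<bullet> z) *\<^sub>R x"
  by (simp add: vec_eq_iff outer_product_def matrix_vector_mult_def inner_vec_def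
      sum_distrib_left mult_ac)

lemma outer_product_scaleR_left: "outer_product (c *\<^sub>R x) y = c *\<^sub>R outer_product x y"
  by (simp add: vec_eq_iff outer_product_def)

lemma matrix_mult_outer_product: "M ** outer_product x y = outer_product (M *v x) y"
  by (simp add: vec_eq_iff outer_product_def matrix_vector_mult_def matrix_matrix_mult_def
      sum_distrib_left mult_ac)

lemma outer_product_mult_matrix: "outer_product x y ** M = outer_product x (transpose M *v y)"
  by (simp add: vec_eq_iff outer_product_def matrix_vector_mult_def matrix_matrix_mult_def
      transpose_def sum_distrib_left mult_ac)

lemma mat_1_plus_outer_product_mult:
  "(mat 1 + outer_product x y) ** (mat 1 + outer_product z w) =
    mat 1 + outer_product x y + outer_product (z + (y \<bullet> z) *\<^sub>R x) w"
  by (simp add: matrix_add_ldistrib matrix_mult_outer_product matrix_vector_mult_add_rdistrib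
      outer_product_mult_vec)

text \<open>Rotating \<open>x\<close> onto a multiple of a basis vector leaves a matrix that differs
  from the identity in a single row.\<close>

lemma det_mat_1_plus_outer_product:
  fixes x y :: "real ^ 'n"
  shows "det (mat 1 + outer_product x y) = 1 + x \<bullet> y"
proof (cases "x = 0")
  case True
  then have "outer_product x y = 0" by (simp add: vec_eq_iff outer_product_def)
  then show ?thesis using True by simp
next
  case False
  fix k :: 'n
  obtain R where R: "orthogonal_matrix R" "R *v axis k 1 = x /\<^sub>R norm x"
    using orthogonal_matrix_exists_basis[of "x /\<^sub>R norm x" k] False by auto
  have RR: "transpose R ** R = mat 1" "R ** transpose R = mat 1"
    using R(1) by (auto simp: orthogonal_matrix_def)
  define w where "w = transpose R *v y"
  have "norm x *\<^sub>R (R *v axis k 1) = x" using R(2) False by simp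
  then have x: "x = R *v (norm x *\<^sub>R axis k 1)"
    by (simp add: matrix_vector_mult_scaleR)
  then have Rx: "transpose R *v x = norm x *\<^sub>R axis k 1"
    using RR by (metis matrix_vector_mul_assoc matrix_vector_mul_lid)
  have "transpose R ** (mat 1 + outer_product x y) ** R =
      mat 1 + outer_product (norm x *\<^sub>R axis k 1) w"
    by (simp add: matrix_add_ldistrib matrix_add_rdistrib matrix_mult_outer_product
        outer_product_mult_matrix Rx w_def RR del: transpose_matrix_vector)
  then have "det (mat 1 + outer_product x y) = det (mat 1 + outer_product (norm x *\<^sub>R axis k 1) w)"
    using RR by (metis det_I det_mul mult.assoc mult.commute mult_1)
  \<comment> \<open>Row \<open>k\<close> is written as a combination of the rows of the identity,
    the shape required by Cramer's lemma.\<close>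
  also have "mat 1 + outer_product (norm x *\<^sub>R axis k 1) w =
      (\<chi> i. if i = k then (\<Sum>i\<in>UNIV. (axis k 1 + norm x *\<^sub>R w) $ i *s row i (mat 1))
        else row i (mat 1))"
    by (auto simp: vec_eq_iff outer_product_def row_def mat_def axis_def if_distrib cong: if_cong)
  also have "det \<dots> = 1 + norm x * w $ k"
    by (subst cramer_lemma_transpose) (simp add: axis_def)
  also have "norm x * w $ k = x \<bullet> y"
  proof -
    have "x \<bullet> y = (norm x *\<^sub>R axis k 1) \<bullet> w"
      unfolding w_def by (subst x) (metis dot_lmul_matrix transpose_matrix_vector inner_commute)
    then show ?thesis by (simp add: inner_axis')
  qed
  finally show ?thesis .
qed

text \<open>Pulling out a Gram factor of \<open>A\<close> leaves a symmetric rank two perturbation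
  of the identity, which splits into two rank one perturbations.\<close>

lemma det_rank_two_perturbation:
  fixes A :: "real ^ 'n ^ 'n"
  assumes sym: "transpose A = A" and pos: "\<And>x. x \<noteq> 0 \<Longrightarrow> x \<bullet> (A *v x) > 0"
    and nz: "1 + c * (x \<bullet> (A *v y)) \<noteq> 0"
  shows "det (A + c *\<^sub>R (outer_product (A *v x) (A *v y) + outer_product (A *v y) (A *v x))) =
    det A * ((1 + c * (x \<bullet> (A *v y)))\<^sup>2 - c\<^sup>2 * (x \<bullet> (A *v x)) * (y \<bullet> (A *v y)))"
proof -
  obtain C where C: "transpose C ** C = A" "det C \<noteq> 0"
    using gram_factorization[OF sym pos] by blast
  define w a where "w = C *v x" and "a = C *v y"
  \<comment> \<open>\<open>d\<close> is the determinant of the first rank one factor;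
    \<open>u\<close> solves \<open>u + c * (a \<bullet> u) *\<^sub>R w = a\<close>, which makes the
    product of the factors symmetric.\<close>
  define d u where "d = 1 + c * (a \<bullet> w)" and "u = a - (c * (a \<bullet> a) / d) *\<^sub>R w"
  have d: "d \<noteq> 0" "d = 1 + c * (x \<bullet> (A *v y))"
    using nz by (auto simp: d_def w_def a_def inner_commute simp flip: C(1) inner_gram)
  have Ax: "A *v x = transpose C *v w" "A *v y = transpose C *v a"
    by (simp_all add: w_def a_def matrix_vector_mul_assoc C(1))
  let ?M = "mat 1 + c *\<^sub>R (outer_product w a + outer_product a w)"
  have "A + c *\<^sub>R (outer_product (A *v x) (A *v y) + outer_product (A *v y) (A *v x)) =
      transpose C ** ?M ** C"
    by (simp add: matrix_add_ldistrib matrix_add_rdistrib matrix_mult_outer_product C(1) Ax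
        outer_product_mult_matrix matrix_scalar_ac outer_product_scaleR_left
        del: transpose_matrix_vector flip: scalar_matrix_assoc)
      (simp only: scaleR_right_distrib outer_product_scaleR_left flip: scaleR_matrix_vector_assoc)
  moreover have "?M = (mat 1 + outer_product (c *\<^sub>R w) a) ** (mat 1 + outer_product (c *\<^sub>R u) w)"
  proof -
    have au: "a \<bullet> u = (a \<bullet> a) / d"
      using d(1) by (simp add: u_def inner_diff_right d_def field_simps)
    have "u + (c * (a \<bullet> u)) *\<^sub>R w = a"
      unfolding au by (simp add: u_def)
    then have cu: "c *\<^sub>R u + (a \<bullet> (c *\<^sub>R u)) *\<^sub>R (c *\<^sub>R w) = c *\<^sub>R a"
      by (metis (no_types, lifting) inner_scaleR_right mult.commute scaleR_right_distrib
          scaleR_scaleR)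
    show ?thesis
      unfolding mat_1_plus_outer_product_mult cu
      by (simp add: outer_product_scaleR_left scaleR_right_distrib)
  qed
  ultimately have "det (A + c *\<^sub>R (outer_product (A *v x) (A *v y) + outer_product (A *v y) (A *v x))) =
      det A * ((1 + c * (w \<bullet> a)) * (1 + c * (u \<bullet> w)))"
    by (simp add: det_mul det_mat_1_plus_outer_product flip: C(1))
  also have "(1 + c * (w \<bullet> a)) * (1 + c * (u \<bullet> w)) = d\<^sup>2 - c\<^sup>2 * (w \<bullet> w) * (a \<bullet> a)"
    using d(1) by (simp add: u_def inner_diff_left inner_commute[of w a] flip: d_def)
      (simp add: field_simps power2_eq_square d_def)
  also have "w \<bullet> w = x \<bullet> (A *v x)"
    by (simp add: w_def flip: C(1) inner_gram)
  also have "a \<bullet> a = y \<bullet> (A *v y)"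
    by (simp add: a_def flip: C(1) inner_gram)
  finally show ?thesis by (simp add: d(2))
qed

section \<open>Unimodular reduction of an integer vector\<close>

definition integer_matrix :: "real ^ 'n ^ 'm \<Rightarrow> bool" where
  "integer_matrix M \<longleftrightarrow> (\<forall>i j. M $ i $ j \<in> \<int>)"

lemma integer_matrix_mat_1 [simp]: "integer_matrix (mat 1)"
  by (simp add: integer_matrix_def mat_def)

lemma integer_matrix_add: "integer_matrix M \<Longrightarrow> integer_matrix N \<Longrightarrow> integer_matrix (M + N)"
  by (simp add: integer_matrix_def)

lemma integer_matrix_mult: "integer_matrix M \<Longrightarrow> integer_matrix N \<Longrightarrow> integer_matrix (M ** N)"
  by (auto simp: integer_matrix_def matrix_matrix_mult_def)

lemma integer_matrix_outer_product:
  "x \<in> integer_vectors \<Longrightarrow> y \<in> integer_vectors \<Longrightarrow> integer_matrix (outer_product x y)"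
  by (auto simp: integer_matrix_def integer_vectors_def outer_product_def)

text \<open>Euclid's algorithm on the entries: as long as two entries are nonzero, subtracting the
  smaller one from the larger one up to sign lowers the sum of absolute values.\<close>

lemma unimodular_reduction_aux:
  fixes v :: "real ^ 'n"
  assumes "v \<in> integer_vectors" "(\<Sum>i\<in>UNIV. \<bar>v $ i\<bar>) \<le> real m"
  shows "\<exists>U W :: real ^ 'n ^ 'n. \<exists>k g. integer_matrix U \<and> integer_matrix W \<and> W ** U = mat 1 \<and>
    U *v v = g *\<^sub>R axis k 1"
  using assms
proof (induction m arbitrary: v)
  case 0
  then have "(\<Sum>i\<in>UNIV. \<bar>v $ i\<bar>) = 0"
    by (intro antisym sum_nonneg) auto
  then have "v = 0" by (simp add: vec_eq_iff sum_nonneg_eq_0_iff)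
  then show ?case by (intro exI[of _ "mat 1"] exI[of _ undefined] exI[of _ 0]) auto
next
  case (Suc m)
  show ?case
  proof (cases "\<exists>i j. i \<noteq> j \<and> v $ i \<noteq> 0 \<and> v $ j \<noteq> 0")
    case False
    then obtain k where "\<And>j. j \<noteq> k \<Longrightarrow> v $ j = 0" by metis
    then have "v = v $ k *\<^sub>R axis k 1" by (auto simp: vec_eq_iff axis_def)
    then show ?thesis by (intro exI[of _ "mat 1"] exI[of _ k] exI[of _ "v $ k"]) auto
  next
    case True
    then obtain i j where ij: "i \<noteq> j" "v $ i \<noteq> 0" "v $ j \<noteq> 0" "\<bar>v $ j\<bar> \<le> \<bar>v $ i\<bar>"
      by (metis linear)
    \<comment> \<open>This sign makes \<open>v $ i - s * v $ j\<close> smaller than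
      \<open>v $ i\<close> by exactly \<open>\<bar>v $ j\<bar>\<close> in absolute value;
      \<open>E\<close> below performs the subtraction and \<open>E'\<close> undoes it.\<close>
    define s where "s = sgn (v $ i) * sgn (v $ j)"
    have s: "s \<in> \<int>" by (auto simp: s_def sgn_if)
    have se: "c *\<^sub>R axis i 1 \<in> integer_vectors" if "c \<in> \<int>" for c :: real
      using that by (intro integer_vectors_scaleR) auto
    define E E' :: "real ^ 'n ^ 'n"
      where "E = mat 1 + outer_product ((- s) *\<^sub>R axis i 1) (axis j 1)"
        and "E' = mat 1 + outer_product (s *\<^sub>R axis i 1) (axis j 1)"
    have E: "integer_matrix E" "integer_matrix E'"
      unfolding E_def E'_def using s
      by (auto intro!: integer_matrix_add integer_matrix_outer_product se simp del: scaleR_minus_left)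
    have "axis j 1 \<bullet> axis i (1 :: real) = 0"
      using ij(1) by (simp add: inner_axis_axis)
    then have E'E: "E' ** E = mat 1"
      unfolding E_def E'_def mat_1_plus_outer_product_mult
      by (simp add: vec_eq_iff outer_product_def)
    have "E *v v = v - (s * v $ j) *\<^sub>R axis i 1"
      by (simp add: E_def matrix_vector_mult_add_rdistrib outer_product_mult_vec inner_axis' mult.commute)
    then have comp: "(E *v v) $ l = (if l = i then v $ i - s * v $ j else v $ l)" for l
      by (auto simp: axis_def)
    have "v $ j \<in> \<int>" using Suc.prems by (auto simp: integer_vectors_def)
    then have one: "1 \<le> \<bar>v $ j\<bar>" using ij(3) by (auto elim!: Ints_cases)
    have red: "\<bar>v $ i - s * v $ j\<bar> = \<bar>v $ i\<bar> - \<bar>v $ j\<bar>"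
      using ij by (auto simp: s_def sgn_if abs_if)
    have "(\<Sum>l\<in>UNIV. \<bar>(E *v v) $ l\<bar>) = \<bar>v $ i\<bar> - \<bar>v $ j\<bar> + (\<Sum>l\<in>UNIV - {i}. \<bar>v $ l\<bar>)"
      by (subst sum.remove[of _ i]) (auto simp: comp red)
    also have "\<dots> = (\<Sum>l\<in>UNIV. \<bar>v $ l\<bar>) - \<bar>v $ j\<bar>"
      by (subst sum.remove[of UNIV i]) auto
    finally have "(\<Sum>l\<in>UNIV. \<bar>(E *v v) $ l\<bar>) \<le> real m" using Suc.prems one by simp
    moreover have "E *v v \<in> integer_vectors"
      using E Suc.prems by (auto intro!: matrix_vector_mult_integer_vectors simp: integer_matrix_def)
    ultimately obtain U W :: "real ^ 'n ^ 'n" and k g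
      where UW: "integer_matrix U" "integer_matrix W" "W ** U = mat 1"
        "U *v (E *v v) = g *\<^sub>R axis k 1"
      using Suc.IH by blast
    have "(E' ** W) ** (U ** E) = E' ** (W ** U) ** E" by (simp add: matrix_mul_assoc)
    then have "(E' ** W) ** (U ** E) = mat 1" using UW E'E by simp
    moreover have "(U ** E) *v v = g *\<^sub>R axis k 1" using UW by (simp flip: matrix_vector_mul_assoc)
    ultimately show ?thesis using UW(1,2) E integer_matrix_mult by blast
  qed
qed

text \<open>The determinants of \<open>U\<close> and \<open>W\<close> are integers with product 1,
  hence units.\<close>

lemma unimodular_reduction:
  fixes v :: "real ^ 'n"
  assumes "v \<in> integer_vectors"
  obtains U W :: "real ^ 'n ^ 'n" and k g where "integer_matrix U" "integer_matrix W"
    "W ** U = mat 1" "\<bar>det W\<bar> = 1" "U *v v = of_int g *\<^sub>R axis k 1"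
proof -
  obtain m where "(\<Sum>i\<in>UNIV. \<bar>v $ i\<bar>) \<le> real m" using real_arch_simple by blast
  then obtain U W :: "real ^ 'n ^ 'n" and k g
    where UW: "integer_matrix U" "integer_matrix W" "W ** U = mat 1" "U *v v = g *\<^sub>R axis k 1"
    using unimodular_reduction_aux[OF assms] by blast
  have det_int: "det M \<in> \<int>" if "integer_matrix M" for M :: "real ^ 'n ^ 'n"
    using that by (auto simp: det_def integer_matrix_def intro!: Ints_sum Ints_mult Ints_prod)
  have "U *v v \<in> integer_vectors"
    using UW(1) by (intro matrix_vector_mult_integer_vectors assms) (auto simp: integer_matrix_def)
  then have "(U *v v) $ k \<in> \<int>" by (simp add: integer_vectors_def)
  then obtain g' where "g = of_int g'" by (auto simp: UW axis_def elim: Ints_cases)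
  moreover have "\<bar>det W\<bar> = 1"
  proof -
    have "det W * det U = 1" using UW(3) by (metis det_I det_mul)
    moreover obtain a b where "det W = of_int a" "det U = of_int b"
      using det_int UW by (metis Ints_cases)
    ultimately have "a * b = 1" by (metis of_int_eq_1_iff of_int_mult)
    then show ?thesis using \<open>det W = of_int a\<close> by (auto simp: zmult_eq_1_iff)
  qed
  ultimately show ?thesis using UW that by blast
qed

text \<open>The columns of \<open>P\<close> are a basis of the lattice generated by \<open>\<int>\<^sup>n\<close> and \<open>v / \<phi>\<close>, in which \<open>\<int>\<^sup>n\<close>
  has index \<open>\<phi>\<close> because \<open>(v, \<phi>)\<close> is primitive.\<close>

lemma exists_superlattice_basis:
  fixes v :: "real ^ 'n" and \<phi> :: int
  assumes v: "v \<in> integer_vectors" and \<phi>: "\<phi> \<ge> 1"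
    and primitive: "\<And>d :: int. d \<ge> 1 \<Longrightarrow> d dvd \<phi> \<Longrightarrow> v /\<^sub>R of_int d \<in> integer_vectors \<Longrightarrow> d = 1"
  obtains P :: "real ^ 'n ^ 'n" where "\<bar>det P\<bar> = 1 / of_int \<phi>"
    "\<And>z. z \<in> integer_vectors \<Longrightarrow>
      \<exists>u\<in>integer_vectors. \<exists>m :: int. P *v z = u - (of_int m / of_int \<phi>) *\<^sub>R v"
proof -
  obtain U W :: "real ^ 'n ^ 'n" and k g where UW: "integer_matrix U" "integer_matrix W"
    "W ** U = mat 1" "\<bar>det W\<bar> = 1" "U *v v = of_int g *\<^sub>R axis k 1"
    using unimodular_reduction[OF v] .
  have Wint: "W *v z \<in> integer_vectors" if "z \<in> integer_vectors" for z
    using UW that by (auto intro!: matrix_vector_mult_integer_vectors simp: integer_matrix_def)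
  have vW: "v = W *v (of_int g *\<^sub>R axis k 1)"
    using UW by (metis matrix_vector_mul_assoc matrix_vector_mul_lid)
  \<comment> \<open>Since \<open>v\<close> is \<open>g\<close> times the integer vector
    \<open>W *v axis k 1\<close>, this gcd divides both \<open>v\<close> and \<open>\<phi>\<close>;
    primitivity makes it 1 and yields Bezout coefficients.\<close>
  define d where "d = gcd g \<phi>"
  have d: "d \<ge> 1" "d dvd \<phi>" "d dvd g"
    using \<phi> by (auto simp: d_def int_one_le_iff_zero_less)
  obtain g' where g': "g = d * g'" using d by auto
  have "v = of_int d *\<^sub>R (of_int g' *\<^sub>R (W *v axis k 1))"
    by (subst vW) (simp add: g' matrix_vector_mult_scaleR)
  then have "v /\<^sub>R of_int d = of_int g' *\<^sub>R (W *v axis k 1)"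
    using d(1) by simp
  also have "\<dots> \<in> integer_vectors"
    by (intro integer_vectors_scaleR Wint) auto
  finally have "d = 1" using primitive d by blast
  then obtain a b where ab: "a * g + b * \<phi> = 1"
    using bezout_int[of g \<phi>] by (auto simp: d_def)
  \<comment> \<open>In the basis of columns of \<open>W\<close>, only the \<open>k\<close>-th
    direction, that of \<open>v\<close>, is refined by \<open>\<phi>\<close>.\<close>
  define D :: "real ^ 'n ^ 'n" where "D = (\<chi> i j. if i = j then if i = k then 1 / of_int \<phi> else 1 else 0)"
  have "det D = 1 / of_int \<phi>"
    unfolding D_def by (subst det_diagonal) (auto simp: prod.delta)
  moreover have "\<exists>u\<in>integer_vectors. \<exists>m :: int. (W ** D) *v z = u - (of_int m / of_int \<phi>) *\<^sub>R v"
    if z: "z \<in> integer_vectors" for z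
  proof -
    obtain c where c: "z $ k = of_int c" using z by (auto simp: integer_vectors_def elim: Ints_cases)
    \<comment> \<open>The \<open>k\<close>-th coordinate of \<open>z'\<close> is
      \<open>c * b\<close>: by Bezout, \<open>c / \<phi>\<close> is \<open>c * b\<close> plus
      \<open>c * a\<close> times \<open>g / \<phi>\<close>.\<close>
    define z' where "z' = z + (of_int (c * b) - of_int c) *\<^sub>R axis k 1"
    have Dz: "(D *v z) $ i = (if i = k then 1 / of_int \<phi> else 1) * z $ i" for i
      by (simp add: D_def matrix_vector_mult_def if_distrib[of "\<lambda>x. x * _"] cong: if_cong)
    have "z' \<in> integer_vectors"
      using z unfolding z'_def by (intro integer_vectors_arith integer_vectors_scaleR) auto
    moreover have "D *v z = z' - (of_int (- (c * a)) / of_int \<phi>) *\<^sub>R (of_int g *\<^sub>R axis k 1)"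
    proof -
      have "of_int (a * g + b * \<phi>) = (1 :: real)" using ab by simp
      then have "of_int c * (of_int a * of_int g + of_int b * of_int \<phi>) = (of_int c :: real)" by simp
      then show ?thesis
        using \<phi> c by (auto simp: vec_eq_iff Dz z'_def axis_def field_simps)
    qed
    ultimately show ?thesis
      using Wint vW
      by (intro bexI[of _ "W *v z'"] exI[of _ "- (c * a)"])
        (simp_all add: matrix_vector_right_distrib matrix_vector_mult_scaleR
          flip: matrix_vector_mul_assoc)
  qed
  ultimately show ?thesis
    using that[of "W ** D"] UW \<phi> by (simp add: det_mul abs_mult)
qed

section \<open>Integral points of the light cone\<close>

locale integral_quadric =
  fixes A :: "real ^ 'n ^ 'n" and \<alpha> :: "real ^ 'n" and \<mu> :: real
  assumes sym: "transpose A = A"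
    and pos: "\<And>x. x \<noteq> 0 \<Longrightarrow> x \<bullet> (A *v x) > 0"
    and integral: "integer_matrix A"
    and alpha: "\<alpha> \<bullet> (A *v \<alpha>) = 1"
    and mu: "\<mu> \<ge> 1"
begin

definition B :: "real ^ 'n \<Rightarrow> real ^ 'n \<Rightarrow> real" where
  "B x y = x \<bullet> (A *v y)"

lemma B_commute: "B x y = B y x"
  unfolding B_def by (rule inner_symmetric_matrix[OF sym])

lemma B_linear [simp]:
  "B (x + y) z = B x z + B y z" "B x (y + z) = B x y + B x z"
  "B (x - y) z = B x z - B y z" "B x (y - z) = B x y - B x z"
  "B (c *\<^sub>R x) z = c * B x z" "B x (c *\<^sub>R z) = c * B x z"
  by (simp_all add: B_def inner_add_left inner_add_right inner_diff_left inner_diff_right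
      matrix_vector_right_distrib matrix_vector_mult_diff_distrib matrix_vector_mult_scaleR)

lemma B_pos: "x \<noteq> 0 \<Longrightarrow> B x x > 0"
  by (simp add: B_def pos)

lemma B_nonneg: "B x x \<ge> 0"
  using B_pos[of x] by (cases "x = 0") (auto simp: B_def)

lemma B_alpha [simp]: "B \<alpha> \<alpha> = 1"
  by (simp add: B_def alpha)

lemma B_Ints: "x \<in> integer_vectors \<Longrightarrow> y \<in> integer_vectors \<Longrightarrow> B x y \<in> \<int>"
  unfolding B_def using integral
  by (intro inner_integer_vectors matrix_vector_mult_integer_vectors) (auto simp: integer_matrix_def)

text \<open>Up to the factor \<open>sqrt 2\<close>, on the future light cone \<open>B v v = t\<^sup>2\<close>, \<open>t \<ge> 0\<close>, this linear form is
  the Euclidean norm after contracting by \<open>\<mu>\<close> the isotropic line through \<open>(\<alpha>, 1)\<close> and dilating by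
  \<open>\<mu>\<close> the one through \<open>(- \<alpha>, 1)\<close>.\<close>

definition height :: "real ^ 'n \<Rightarrow> real \<Rightarrow> real" where
  "height v t = \<mu> * (t - B \<alpha> v) + (t + B \<alpha> v) / \<mu>"

text \<open>Cauchy-Schwarz gives \<open>\<bar>B \<alpha> v\<bar> \<le> t\<close>, so both terms of
  the height are nonnegative. The first bound will control the denominator, the second the distance
  to \<open>\<alpha>\<close>.\<close>

lemma height_bounds:
  assumes "B v v = t\<^sup>2" "t \<ge> 0"
  shows "2 * t \<le> \<mu> * height v t" "\<mu> * (t - B \<alpha> v) \<le> height v t"
proof -
  have "0 \<le> B (v - B \<alpha> v *\<^sub>R \<alpha>) (v - B \<alpha> v *\<^sub>R \<alpha>)" by (rule B_nonneg)
  then have "(B \<alpha> v)\<^sup>2 \<le> t\<^sup>2"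
    using assms(1) B_commute[of v \<alpha>] by (simp add: power2_eq_square algebra_simps)
  then have "\<bar>B \<alpha> v\<bar> \<le> t" using assms(2) by (simp add: abs_le_square_iff[symmetric])
  then have ts: "0 \<le> t - B \<alpha> v" "0 \<le> t + B \<alpha> v" by auto
  show "\<mu> * (t - B \<alpha> v) \<le> height v t" using ts mu by (simp add: height_def)
  have "1 * (t - B \<alpha> v) \<le> \<mu>\<^sup>2 * (t - B \<alpha> v)"
    using ts mu by (intro mult_right_mono) auto
  moreover have "\<mu> * height v t = \<mu>\<^sup>2 * (t - B \<alpha> v) + (t + B \<alpha> v)"
    using mu by (simp add: height_def field_simps power2_eq_square)
  ultimately show "2 * t \<le> \<mu> * height v t" by (simp add: algebra_simps)
qed

lemma height_pos: "B v v = t\<^sup>2 \<Longrightarrow> t > 0 \<Longrightarrow> height v t > 0"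
  using height_bounds(1)[of v t] mu by (smt (verit) mult_nonneg_nonpos)

text \<open>The reflection of \<open>v / t\<close> in the hyperplane orthogonal to \<open>y\<close>, in homogeneous coordinates.\<close>

definition reflect :: "real ^ 'n \<Rightarrow> real ^ 'n \<Rightarrow> real ^ 'n" where
  "reflect y v = B y y *\<^sub>R v - (2 * B v y) *\<^sub>R y"

lemma B_reflect: "B (reflect y v) (reflect y v) = (B y y)\<^sup>2 * B v v"
  using B_commute[of y v] by (simp add: reflect_def algebra_simps power2_eq_square)

text \<open>The height is linear in \<open>(v, t)\<close>, and the reflection adds a multiple of
  \<open>(y, 0)\<close> to a multiple of \<open>(v, t)\<close>.\<close>

lemma height_reflect:
  "height (reflect y v) (B y y * t) = B y y * height v t + 2 * (\<mu> - 1 / \<mu>) * B v y * B \<alpha> y"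
  using mu by (simp add: height_def reflect_def field_simps)

definition light_cone :: "((real ^ 'n) \<times> int) set" where
  "light_cone = {(v, \<phi>). v \<in> integer_vectors \<and> \<phi> \<ge> 1 \<and> B v v = (of_int \<phi>)\<^sup>2}"

text \<open>With \<open>b = (u, m)\<close>, and \<open>Q\<close> and \<open>\<langle>\<cdot>, \<cdot>\<rangle>\<close> denoting \<open>B x x - t\<^sup>2\<close> and its polar form, the
  reflected vector is \<open>Q(b) a - 2 \<langle>a, b\<rangle> b\<close> with \<open>a = (v, \<phi>)\<close>; hence it is integral although \<open>y\<close>
  is not.\<close>

lemma reflect_in_light_cone:
  assumes v: "(v, \<phi>) \<in> light_cone" and u: "u \<in> integer_vectors"
    and y: "y = u - (of_int m / of_int \<phi>) *\<^sub>R v" "y \<noteq> 0"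
  obtains \<phi>' where "(reflect y v, \<phi>') \<in> light_cone" "of_int \<phi>' = B y y * of_int \<phi>"
proof -
  have \<phi>: "\<phi> \<ge> 1" and vv: "B v v = (of_int \<phi>)\<^sup>2" and vint: "v \<in> integer_vectors"
    using v by (auto simp: light_cone_def)
  have yy: "B y y = B u u - 2 * (of_int m / of_int \<phi>) * B v u + (of_int m)\<^sup>2"
    using \<phi> B_commute[of u v] by (simp add: y vv field_simps power2_eq_square)
  have vy: "B v y = B v u - of_int m * of_int \<phi>"
    using \<phi> by (simp add: y vv power2_eq_square)
  \<comment> \<open>This is the last coordinate of the reflected vector, free of denominators
    because \<open>(v, \<phi>)\<close> is isotropic.\<close>
  have "B y y * of_int \<phi> = of_int \<phi> * (B u u + (of_int m)\<^sup>2) - 2 * of_int m * B v u"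
    using \<phi> by (simp add: yy field_simps)
  also have "\<dots> \<in> \<int>" using B_Ints u vint by auto
  finally obtain \<phi>' :: int where \<phi>': "of_int \<phi>' = B y y * of_int \<phi>" by (metis Ints_cases)
  have "reflect y v = (B u u - (of_int m)\<^sup>2) *\<^sub>R v - (2 * (B v u - of_int m * of_int \<phi>)) *\<^sub>R u"
  proof -
    have "reflect y v = B y y *\<^sub>R v - (2 * B v y) *\<^sub>R (u - (of_int m / of_int \<phi>) *\<^sub>R v)"
      by (simp only: reflect_def flip: y(1))
    also have "\<dots> = (B y y + 2 * B v y * (of_int m / of_int \<phi>)) *\<^sub>R v - (2 * B v y) *\<^sub>R u"
      by (simp add: scaleR_diff_right scaleR_add_left)
    also have "B y y + 2 * B v y * (of_int m / of_int \<phi>) = B u u - (of_int m)\<^sup>2"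
      using \<phi> by (simp add: yy vy field_simps power2_eq_square)
    finally show ?thesis by (simp add: vy)
  qed
  also have "\<dots> \<in> integer_vectors"
    using u vint by (intro integer_vectors_arith integer_vectors_scaleR) (auto intro!: B_Ints Ints_mult)
  finally have "reflect y v \<in> integer_vectors" .
  moreover have "of_int \<phi>' > (0 :: real)" using \<phi>' B_pos y(2) \<phi> by simp
  then have "\<phi>' \<ge> 1" by simp
  ultimately have "(reflect y v, \<phi>') \<in> light_cone"
    by (simp add: light_cone_def B_reflect vv \<phi>' power_mult_distrib)
  then show ?thesis using that \<phi>' by blast
qed

section \<open>Points of minimal height\<close>

text \<open>A bound on the height bounds \<open>\<phi>\<close>, hence also \<open>v\<close> because
  \<open>B\<close> is positive definite; only finitely many integral points remain.\<close>

lemma exists_minimal_height: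
  assumes "light_cone \<noteq> {}"
  obtains v \<phi> where "(v, \<phi>) \<in> light_cone"
    "\<And>w \<psi>. (w, \<psi>) \<in> light_cone \<Longrightarrow> height v (of_int \<phi>) \<le> height w (of_int \<psi>)"
proof -
  obtain w0 \<psi>0 where w0: "(w0, \<psi>0) \<in> light_cone" using assms by auto
  define h where "h = height w0 (of_int \<psi>0)"
  obtain C where C: "transpose C ** C = A" "det C \<noteq> 0"
    using gram_factorization[OF sym pos] by blast
  have "inj ((*v) C)"
    using C(2) by (metis invertible_def invertible_det_nz matrix_left_invertible_injective)
  then obtain b where b: "b > 0" "\<And>x. b * norm x \<le> norm (C *v x)"
    using linear_inj_bounded_below_pos[of "(*v) C"] by auto
  have BC: "B x x = (norm (C *v x))\<^sup>2" for x
    using inner_gram[of x C x] C(1) by (simp add: B_def power2_norm_eq_inner)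
  define S where "S = {(w, \<psi>) \<in> light_cone. height w (of_int \<psi>) \<le> h}"
  have "S \<subseteq> {z \<in> integer_vectors. norm z \<le> \<mu> * h / (2 * b)} \<times> {1..\<lfloor>\<mu> * h / 2\<rfloor>}"
  proof (rule subrelI)
    fix w \<psi> assume "(w, \<psi>) \<in> S"
    then have w: "w \<in> integer_vectors" "\<psi> \<ge> 1" "B w w = (of_int \<psi>)\<^sup>2" "height w (of_int \<psi>) \<le> h"
      by (auto simp: S_def light_cone_def)
    have "2 * of_int \<psi> \<le> \<mu> * height w (of_int \<psi>)" using w by (intro height_bounds) auto
    also have "\<dots> \<le> \<mu> * h" using w mu by simp
    finally have le: "of_int \<psi> \<le> \<mu> * h / 2" by simp
    have "norm (C *v w) = of_int \<psi>" using w(2,3) by (simp add: BC power2_eq_iff_nonneg)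
    then have "norm w \<le> \<mu> * h / (2 * b)"
      using b(2)[of w] b(1) le by (simp add: field_simps)
    then show "(w, \<psi>) \<in> {z \<in> integer_vectors. norm z \<le> \<mu> * h / (2 * b)} \<times> {1..\<lfloor>\<mu> * h / 2\<rfloor>}"
      using w le by (simp add: le_floor_iff)
  qed
  then have "finite S"
    by (rule finite_subset) (intro finite_cartesian_product finite_bounded_integer_vectors, simp)
  moreover have "(w0, \<psi>0) \<in> S" using w0 by (simp add: S_def h_def)
  ultimately obtain p where "is_arg_min (\<lambda>r. height (fst r) (of_int (snd r))) (\<lambda>r. r \<in> S) p"
    using ex_is_arg_min_if_finite by blast
  then have p: "p \<in> S"
      "\<And>r. r \<in> S \<Longrightarrow> height (fst p) (of_int (snd p)) \<le> height (fst r) (of_int (snd r))"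
    by (auto simp: is_arg_min_linorder)
  have "height (fst p) (of_int (snd p)) \<le> height w (of_int \<psi>)" if "(w, \<psi>) \<in> light_cone" for w \<psi>
  proof (cases "height w (of_int \<psi>) \<le> h")
    case True
    then show ?thesis using p(2)[of "(w, \<psi>)"] that by (simp add: S_def)
  next
    case False
    then show ?thesis using p(1) by (auto simp: S_def)
  qed
  moreover have "(fst p, snd p) \<in> light_cone" using p(1) by (auto simp: S_def)
  ultimately show ?thesis using that by blast
qed

text \<open>The matrix of the quadratic form sending \<open>y\<close> to the ratio of the heights
  after and before reflection along \<open>y\<close>.\<close>

definition reflection_matrix :: "real ^ 'n \<Rightarrow> real \<Rightarrow> real ^ 'n ^ 'n" where
  "reflection_matrix v t = A + ((\<mu> - 1 / \<mu>) / height v t) *\<^sub>R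
    (outer_product (A *v v) (A *v \<alpha>) + outer_product (A *v \<alpha>) (A *v v))"

lemma reflection_matrix_form:
  assumes "height v t \<noteq> 0"
  shows "y \<bullet> (reflection_matrix v t *v y) = height (reflect y v) (B y y * t) / height v t"
proof -
  have eq: "(A *v x) \<bullet> y = B x y" "y \<bullet> (A *v x) = B x y" for x
    by (metis B_commute B_def inner_commute)+
  have "y \<bullet> (reflection_matrix v t *v y) =
      B y y + (\<mu> - 1 / \<mu>) / height v t * (2 * B v y * B \<alpha> y)"
    by (simp add: reflection_matrix_def matrix_vector_mult_add_rdistrib outer_product_mult_vec
        inner_add_right eq flip: scaleR_matrix_vector_assoc)
  then show ?thesis unfolding height_reflect using assms by (simp add: field_simps)
qed

text \<open>The squares of \<open>\<mu> + 1 / \<mu>\<close> and \<open>\<mu> - 1 / \<mu>\<close>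
  differ by 4, so \<open>\<mu>\<close> survives only inside the height.\<close>

lemma det_reflection_matrix:
  assumes v: "B v v = t\<^sup>2" "t > 0"
  shows "det (reflection_matrix v t) = det A * (4 * t\<^sup>2 / (height v t)\<^sup>2)"
proof -
  let ?h = "height v t" and ?c = "(\<mu> - 1 / \<mu>) / height v t"
  have h: "?h > 0" using height_pos v by auto
  have one: "1 + ?c * B v \<alpha> = (\<mu> + 1 / \<mu>) * t / ?h"
    using h by (simp add: field_simps B_commute[of v \<alpha>]) (use mu in \<open>simp add: height_def field_simps\<close>)
  moreover have "(\<mu> + 1 / \<mu>) * t / ?h \<noteq> 0"
  proof -
    have "\<mu> + 1 / \<mu> > 0" using mu by (intro add_pos_pos) auto
    then show ?thesis using h v(2) by simp
  qed
  ultimately have "det (reflection_matrix v t) =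
      det A * (((\<mu> + 1 / \<mu>) * t / ?h)\<^sup>2 - ?c\<^sup>2 * t\<^sup>2 * 1)"
    unfolding reflection_matrix_def
    using det_rank_two_perturbation[OF sym pos, of ?c v \<alpha>]
    by (simp only: v(1) B_alpha one flip: B_def) simp
  also have "(a * t / ?h)\<^sup>2 - (b / ?h)\<^sup>2 * t\<^sup>2 * 1 = (a\<^sup>2 - b\<^sup>2) * t\<^sup>2 / ?h\<^sup>2" for a b
    by (simp add: power_divide power_mult_distrib left_diff_distrib diff_divide_distrib)
  also have "(\<mu> + 1 / \<mu>)\<^sup>2 - (\<mu> - 1 / \<mu>)\<^sup>2 = 4"
    using mu by (simp add: power2_eq_square field_simps)
  finally show ?thesis by simp
qed

lemma transpose_reflection_matrix: "transpose (reflection_matrix v t) = reflection_matrix v t"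
proof -
  have "A $ j $ i = A $ i $ j" for i j
    using sym by (metis transpose_def vec_lambda_beta)
  then show ?thesis
    by (simp add: vec_eq_iff transpose_def reflection_matrix_def outer_product_def algebra_simps)
qed

theorem minimal_height_bound:
  assumes "light_cone \<noteq> {}"
  obtains v \<phi> where "(v, \<phi>) \<in> light_cone"
    "(height v (of_int \<phi>))\<^sup>2 \<le> 4 * hermite_constant TYPE('n) ^ CARD('n) * det A"
proof -
  obtain v \<phi> where v: "(v, \<phi>) \<in> light_cone"
    and min: "\<And>w \<psi>. (w, \<psi>) \<in> light_cone \<Longrightarrow> height v (of_int \<phi>) \<le> height w (of_int \<psi>)"
    using exists_minimal_height[OF assms] by blast
  have vint: "v \<in> integer_vectors" and \<phi>: "\<phi> \<ge> 1" and vv: "B v v = (of_int \<phi>)\<^sup>2"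
    using v by (auto simp: light_cone_def)
  let ?h = "height v (of_int \<phi>)"
  have h: "?h > 0" using height_pos[OF vv] \<phi> by simp
  \<comment> \<open>Dividing by a common divisor \<open>d\<close> stays on the cone and divides the
    height by \<open>d\<close>, against minimality unless \<open>d = 1\<close>.\<close>
  have primitive: "d = 1" if d: "d \<ge> 1" "d dvd \<phi>" "v /\<^sub>R of_int d \<in> integer_vectors" for d :: int
  proof -
    obtain e where e: "\<phi> = d * e" using d by auto
    have "e \<ge> 1" using \<phi> d(1) e by (smt (verit) mult_nonneg_nonpos)
    then have "(v /\<^sub>R of_int d, e) \<in> light_cone"
      using d(1,3) vv by (simp add: light_cone_def e field_simps power2_eq_square)
    then have "?h \<le> height (v /\<^sub>R of_int d) (of_int e)" by (rule min)
    also have "\<dots> = ?h / of_int d"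
      using d(1) mu by (simp add: height_def e field_simps)
    finally have "?h * of_int d \<le> ?h" using d(1) by (simp add: field_simps)
    then show ?thesis using h d(1) by simp
  qed
  obtain P :: "real ^ 'n ^ 'n" where detP: "\<bar>det P\<bar> = 1 / of_int \<phi>"
    and P: "\<And>z. z \<in> integer_vectors \<Longrightarrow>
      \<exists>u\<in>integer_vectors. \<exists>m :: int. P *v z = u - (of_int m / of_int \<phi>) *\<^sub>R v"
    using exists_superlattice_basis[OF vint \<phi> primitive] by blast
  have "det P \<noteq> 0" using detP \<phi> by auto
  then have Pz: "P *v z \<noteq> 0" if "z \<noteq> 0" for z
    using that by (metis invertible_def invertible_det_nz matrix_left_invertible_ker)
  define G where "G = transpose P ** reflection_matrix v (of_int \<phi>) ** P"
  have form: "z \<bullet> (G *v z) =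
      height (reflect (P *v z) v) (B (P *v z) (P *v z) * of_int \<phi>) / ?h" for z
  proof -
    have "z \<bullet> (G *v z) = (P *v z) \<bullet> (reflection_matrix v (of_int \<phi>) *v (P *v z))"
      unfolding G_def by (metis dot_lmul_matrix matrix_vector_mul_assoc transpose_matrix_vector transpose_transpose)
    then show ?thesis using reflection_matrix_form h by simp
  qed
  have "1 ^ CARD('n) \<le> hermite_constant TYPE('n) ^ CARD('n) * det G"
  proof (rule hermite_inequality)
    show "transpose G = G"
      by (simp add: G_def matrix_transpose_mul transpose_reflection_matrix matrix_mul_assoc)
    show "z \<bullet> (G *v z) > 0" if "z \<noteq> 0" for z
    proof -
      \<comment> \<open>For real \<open>z\<close> the reflected point need not be integral, but it
        lies on the cone with positive last coordinate.\<close>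
      have "height (reflect (P *v z) v) (B (P *v z) (P *v z) * of_int \<phi>) > 0"
        using B_pos[OF Pz[OF that]] \<phi>
        by (intro height_pos) (auto simp: B_reflect vv power_mult_distrib)
      then show ?thesis using form h by simp
    qed
    show "1 \<le> z \<bullet> (G *v z)" if z: "z \<in> integer_vectors" "z \<noteq> 0" for z
    proof -
      obtain u m where "u \<in> integer_vectors" "P *v z = u - (of_int m / of_int \<phi>) *\<^sub>R v"
        using P[OF z(1)] by blast
      then obtain \<phi>' where "(reflect (P *v z) v, \<phi>') \<in> light_cone"
          "of_int \<phi>' = B (P *v z) (P *v z) * of_int \<phi>"
        using reflect_in_light_cone[OF v] Pz[OF z(2)] by metis
      then have "?h \<le> height (reflect (P *v z) v) (B (P *v z) (P *v z) * of_int \<phi>)"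
        using min by metis
      then show ?thesis using form h by simp
    qed
  qed simp
  moreover have "det G = 4 * det A / ?h\<^sup>2"
  proof -
    have "det G = (det P)\<^sup>2 * det (reflection_matrix v (of_int \<phi>))"
      by (simp add: G_def det_mul power2_eq_square)
    moreover have "(det P)\<^sup>2 = (1 / of_int \<phi>)\<^sup>2" using detP by (metis power2_abs)
    ultimately show ?thesis
      using det_reflection_matrix[OF vv] \<phi> by (simp add: power_divide)
  qed
  ultimately have "?h\<^sup>2 \<le> 4 * hermite_constant TYPE('n) ^ CARD('n) * det A"
    using h by (simp add: field_simps)
  then show ?thesis using v that by blast
qed

end

section \<open>Choice of the flow parameter and final estimates\<close>

lemma rational_vector_common_denominator:
  fixes x :: "real ^ 'n"
  assumes "x \<in> rational_vectors"
  obtains N :: int where "N \<ge> 1" "of_int N *\<^sub>R x \<in> integer_vectors"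
proof -
  have "\<exists>d::int. d \<ge> 1 \<and> of_int d * x $ i \<in> \<int>" for i
  proof -
    have "x $ i \<in> \<rat>" using assms by (simp add: rational_vectors_def)
    then obtain a b :: int where "b > 0" "x $ i = of_int a / of_int b"
      by (rule Rats_cases')
    then show ?thesis by (intro exI[of _ b]) auto
  qed
  then obtain d :: "'n \<Rightarrow> int" where d: "\<And>i. d i \<ge> 1" "\<And>i. of_int (d i) * x $ i \<in> \<int>"
    by metis
  show ?thesis
  proof (rule that)
    show "(\<Prod>i\<in>UNIV. d i) \<ge> 1" using d(1) by (simp add: prod_ge_1)
    have "of_int (\<Prod>i\<in>UNIV. d i) * x $ j = of_int (\<Prod>i\<in>UNIV - {j}. d i) * (of_int (d j) * x $ j)" for j
      by (subst prod.remove[of UNIV j]) auto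
    then have "of_int (\<Prod>i\<in>UNIV. d i) * x $ j \<in> \<int>" for j
      using d(2)[of j] by (metis Ints_mult Ints_of_int)
    then show "of_int (\<Prod>i\<in>UNIV. d i) *\<^sub>R x \<in> integer_vectors"
      by (simp add: integer_vectors_def)
  qed
qed

theorem theorem1:
  fixes q :: "real ^ 'n \<Rightarrow> real" and A :: "real ^ 'n ^ 'n"
    and \<alpha> :: "real ^ 'n" and T :: real
  assumes form: "\<And>x. q x = x \<bullet> (A *v x)"
    and symmetric: "transpose A = A"
    and pos_def: "\<And>x. x \<noteq> 0 \<Longrightarrow> q x > 0"
    and integral: "\<And>i j. A $ i $ j \<in> \<int>"
    and rational_point: "\<exists>x \<in> rational_vectors. q x = 1"
    and alpha: "q \<alpha> = 1"
    and T: "T \<ge> (2 * hermite_constant TYPE('n)) powr (real CARD('n) / 2) * sqrt (det A)"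
  shows "\<exists>\<upsilon> \<in> integer_vectors. \<exists>\<phi> :: int. 1 \<le> \<phi> \<and> real_of_int \<phi> \<le> T \<and>
    q (\<upsilon> /\<^sub>R real_of_int \<phi>) = 1 \<and>
    q (\<alpha> - \<upsilon> /\<^sub>R real_of_int \<phi>)
      \<le> sqrt 8 * (2 * hermite_constant TYPE('n)) ^ CARD('n) * det A / (real_of_int \<phi> * T)"
proof -
  let ?g = "hermite_constant TYPE('n)" and ?n = "CARD('n)"
  have pos: "x \<bullet> (A *v x) > 0" if "x \<noteq> 0" for x using pos_def that by (simp add: form)
  \<comment> \<open>An integral positive definite form has minimum at least 1, so Hermite's
    inequality bounds \<open>?g ^ ?n * det A\<close> below by 1.\<close>
  have ge1: "1 \<le> z \<bullet> (A *v z)" if z: "z \<in> integer_vectors" "z \<noteq> 0" for z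
  proof -
    have "z \<bullet> (A *v z) \<in> \<int>"
      by (intro inner_integer_vectors matrix_vector_mult_integer_vectors integral z)
    then show ?thesis using pos[OF z(2)] by (auto elim!: Ints_cases)
  qed
  have g: "?g > 0" "1 \<le> ?g ^ ?n * det A"
    using hermite_inequality[OF symmetric pos, of 1] ge1 by auto
  \<comment> \<open>The minimal height is at most \<open>2 * F\<close>, and the threshold imposed on
    \<open>T\<close> is \<open>sqrt (2 ^ ?n) * F\<close>, hence at least \<open>F\<close>.\<close>
  define F where "F = sqrt (?g ^ ?n * det A)"
  have F: "F > 0" "F\<^sup>2 = ?g ^ ?n * det A" using g by (auto simp: F_def)
  have "det A > 0" using g by (smt (verit) mult_nonneg_nonpos zero_le_power)
  have "(2 * ?g) powr (real ?n / 2) * sqrt (det A) = sqrt (2 ^ ?n) * F"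
  proof -
    have "(2 * ?g) powr (real ?n / 2) = sqrt ((2 * ?g) powr real ?n)"
      by (simp add: powr_half_sqrt[symmetric] powr_powr)
    then show ?thesis using g by (simp add: powr_realpow F_def real_sqrt_mult power_mult_distrib)
  qed
  moreover have "1 * F \<le> sqrt (2 ^ ?n) * F" using F by (intro mult_right_mono) auto
  ultimately have FT: "F \<le> T" using T by linarith
  \<comment> \<open>With \<open>\<mu> = T / F\<close>, a height of at most \<open>2 * F\<close>
    turns \<open>2 * \<phi> \<le> \<mu> * height\<close> into \<open>\<phi> \<le> T\<close>.\<close>
  interpret integral_quadric A \<alpha> "T / F"
    using symmetric pos integral alpha FT F by unfold_locales (auto simp: integer_matrix_def form)
  have q: "q x = B x x" for x by (simp add: B_def form)
  have "light_cone \<noteq> {}"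
  proof -
    obtain x where x: "x \<in> rational_vectors" "q x = 1" using rational_point by blast
    obtain N :: int where "N \<ge> 1" "of_int N *\<^sub>R x \<in> integer_vectors"
      using rational_vector_common_denominator[OF x(1)] .
    then have "(of_int N *\<^sub>R x, N) \<in> light_cone"
      using x(2) by (simp add: light_cone_def q power2_eq_square)
    then show ?thesis by blast
  qed
  then obtain v \<phi> where v: "(v, \<phi>) \<in> light_cone" "(height v (of_int \<phi>))\<^sup>2 \<le> 4 * ?g ^ ?n * det A"
    using minimal_height_bound by blast
  then have vint: "v \<in> integer_vectors" and \<phi>: "\<phi> \<ge> 1" and vv: "B v v = (of_int \<phi>)\<^sup>2"
    by (auto simp: light_cone_def)
  have "(height v (of_int \<phi>))\<^sup>2 \<le> (2 * F)\<^sup>2" using v(2) by (simp add: power_mult_distrib F(2))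
  then have hF: "height v (of_int \<phi>) \<le> 2 * F" by (rule power2_le_imp_le) (use F(1) in simp)
  have bounds: "2 * of_int \<phi> \<le> T / F * height v (of_int \<phi>)"
      "T / F * (of_int \<phi> - B \<alpha> v) \<le> height v (of_int \<phi>)"
    using height_bounds[OF vv] \<phi> by auto
  have Tpos: "T > 0" using F FT by linarith
  have "T / F * height v (of_int \<phi>) \<le> T / F * (2 * F)"
    using hF Tpos F by (intro mult_left_mono) auto
  then have \<phi>T: "of_int \<phi> \<le> T" using bounds(1) F by simp
  have "T * (of_int \<phi> - B \<alpha> v) \<le> height v (of_int \<phi>) * F"
    using bounds(2) F by (simp add: field_simps)
  also have "\<dots> \<le> 2 * F * F" using hF F by (intro mult_right_mono) auto
  finally have gap: "T * (of_int \<phi> - B \<alpha> v) \<le> 2 * (?g ^ ?n * det A)"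
    using F(2) by (simp add: power2_eq_square)
  \<comment> \<open>Both points lie on \<open>q = 1\<close>, so the squared distance is
    \<open>2 - 2 * B \<alpha> v / \<phi>\<close>.\<close>
  have "q (\<alpha> - v /\<^sub>R of_int \<phi>) = 2 * (T * (of_int \<phi> - B \<alpha> v)) / (of_int \<phi> * T)"
    using \<phi> Tpos B_commute[of v \<alpha>] by (simp add: q vv field_simps power2_eq_square)
  also have "\<dots> \<le> 4 * (?g ^ ?n * det A) / (of_int \<phi> * T)"
    using gap \<phi> Tpos by (intro divide_right_mono) (linarith, simp)
  \<comment> \<open>The constant 4 obtained so far is relaxed to the stated one, using that the
    dimension is at least 1.\<close>
  also have "\<dots> \<le> (sqrt 8 * 2 ^ ?n) * (?g ^ ?n * det A) / (of_int \<phi> * T)"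
  proof (intro divide_right_mono mult_right_mono)
    have "(2 :: real) \<le> sqrt 8" by (rule real_le_rsqrt) simp
    moreover have "(2 :: real) ^ 1 \<le> 2 ^ ?n" by (intro power_increasing) (auto simp: Suc_le_eq)
    ultimately have "2 * 2 ^ 1 \<le> sqrt 8 * (2 :: real) ^ ?n" by (intro mult_mono) auto
    then show "4 \<le> sqrt 8 * (2 :: real) ^ ?n" by simp
  qed (use g \<phi> Tpos in auto)
  finally have "q (\<alpha> - v /\<^sub>R of_int \<phi>) \<le> sqrt 8 * (2 * ?g) ^ ?n * det A / (of_int \<phi> * T)"
    by (simp add: power_mult_distrib mult.assoc)
  moreover have "q (v /\<^sub>R of_int \<phi>) = 1"
    using \<phi> by (simp add: q vv power2_eq_square field_simps)
  ultimately show ?thesis using vint \<phi> \<phi>T by blast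
qed

end
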